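(* Let $p\in[1,2]$ and $A,B\in\mathcal{H}_n^{(\beta)}$. Then $$\mathcal{W}_p(\mu_A,\mu_B)\le\frac1{n^{1/p}}\|A-B\|_{\ell^p}.$$ As a consequence, $$d(\mu_A,\mu_B)\le\frac1{n^{1/p}}\|A-B\|_{\ell^p}.$$
   Context: $\mathcal{H}_n^{(\beta)}$ is the set of $n\times n$ Hermitian matrices if $\beta=2$ and real symmetric matrices if $\beta=1$. $\mu_A=\frac1n\sum_i\delta_{\lambda_i}$ is the empirical spectral measure of $A$ ($\lambda_i$ its eigenvalues). $\|Y\|_{\ell^p}=(\sum_{i,j}|Y_{i,j}|^p)^{1/p}$ (entrywise). For $p\ge1$, $\mathcal{W}_p(\mu,\nu)=\big(\inf_\pi\int|x-y|^pd\pi(x,y)\big)^{1/p}$, infimum over couplings $\pi$ of $\mu$ and $\nu$. The distance $d$ on probability measures on $\mathbb{R}$ is $d(\mu,\nu)=\sup_{z\in\mathcal{K}}|g_\mu(z)-g_\nu(z)|$, where $g_\mu(z)=\int\frac{d\mu(t)}{z-t}$ is the Stieltjes transform and $\mathcal{K}$ is a fixed compact subset of $\{z\in\mathbb{C}:\mathrm{Im}\,z\ge2\}$ with an accumulation point and with $\mathrm{diam}(\mathcal{K})\le1$. *)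

theory Defs
  imports
    "HOL-Probability.Probability"
    "Jordan_Normal_Form.Schur_Decomposition"
begin

(* Both symmetry classes live in complex matrices; a real symmetric matrix is one whose entries
   all lie in \<real>.  Meaningful for b = 1 and b = 2 only. *)
definition herm_mats :: "nat \<Rightarrow> nat \<Rightarrow> complex mat set" where
  "herm_mats b n =
     (if b = 1 then {A \<in> carrier_mat n n. transpose_mat A = A \<and> elements_mat A \<subseteq> \<real>}
      else {A \<in> carrier_mat n n. mat_adjoint A = A})"

definition eigenvalues_mset :: "complex mat \<Rightarrow> complex multiset" where
  "eigenvalues_mset A = proots (char_poly A)"

(* The uniform distribution on the multiset of eigenvalues, i.e. (1/n) times the sum of the Dirac
   masses at the n eigenvalues counted with multiplicity.  The eigenvalues of a Hermitian matrix
   are real, so Re only changes the type. *)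
definition spectral_measure :: "complex mat \<Rightarrow> real measure" where
  "spectral_measure A = distr (measure_pmf (pmf_of_multiset (eigenvalues_mset A))) borel Re"

definition lp_norm_mat :: "real \<Rightarrow> complex mat \<Rightarrow> real" where
  "lp_norm_mat p Y =
     (\<Sum>i<dim_row Y. \<Sum>j<dim_col Y. cmod (Y $$ (i, j)) powr p) powr (1 / p)"

definition couplings :: "real measure \<Rightarrow> real measure \<Rightarrow> (real \<times> real) measure set" where
  "couplings \<mu> \<nu> =
     {\<pi>. sets \<pi> = sets (borel \<Otimes>\<^sub>M borel) \<and> distr \<pi> borel fst = \<mu> \<and> distr \<pi> borel snd = \<nu>}"

(* The infimum may be infinite for general \<mu>, \<nu>, hence values in ennreal; the case
   distinction is the p-th root on ennreal. *)
definition wasserstein :: "real \<Rightarrow> real measure \<Rightarrow> real measure \<Rightarrow> ennreal" where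
  "wasserstein p \<mu> \<nu> =
     (let c = (INF \<pi>\<in>couplings \<mu> \<nu>. \<integral>\<^sup>+(x, y). ennreal (\<bar>x - y\<bar> powr p) \<partial>\<pi>)
      in if c = \<infinity> then \<infinity> else ennreal (enn2real c powr (1 / p)))"

definition stieltjes :: "real measure \<Rightarrow> complex \<Rightarrow> complex" where
  "stieltjes \<mu> z = (LINT t|\<mu>. 1 / (z - complex_of_real t))"

definition stieltjes_dist :: "complex set \<Rightarrow> real measure \<Rightarrow> real measure \<Rightarrow> real" where
  "stieltjes_dist K \<mu> \<nu> = (SUP z\<in>K. cmod (stieltjes \<mu> z - stieltjes \<nu> z))"

end

theory Submission
  imports Defs
begin

text \<open>The matching of the two spectra in decreasing order already achieves the bound. Let \<open>\<alpha> i\<close> and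
  \<open>\<beta> i\<close> be the eigenvalues of \<open>A\<close> and \<open>B\<close> in this order and \<open>\<gamma> i\<close> those of \<open>C = A - B\<close>. The core of the
  proof is the chain of inequalities
  \<open>\<Sum>\<^sub>i |\<alpha> i - \<beta> i| powr p \<le> \<Sum>\<^sub>i |\<gamma> i| powr p \<le> \<Sum>\<^sub>i\<^sub>j |C i j| powr p\<close>.

  The first one is a Lidskii-type inequality and holds for all \<open>p \<ge> 1\<close>. For a threshold \<open>s\<close>, the
  matrix \<open>D = B + s + (C - s)\<^sub>+\<close> dominates both \<open>A\<close> and \<open>B + s\<close>. Weyl's monotonicity principle
  (\<open>weyl_monotonicity\<close>) turns this into inequalities between the ordered eigenvalues, and taking
  traces yields \<open>\<Sum>\<^sub>i (\<alpha> i - \<beta> i - s)\<^sub>+ \<le> \<Sum>\<^sub>i (\<gamma> i - s)\<^sub>+\<close>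
  (\<open>sum_excess_eigenvalue_differences_le\<close>). Integrating over \<open>s\<close> with a suitable weight produces
  the \<open>p\<close>-th powers (\<open>sum_powr_eigenvalue_differences_le\<close>).

  The second one is the comparison of the Schatten norm with the entrywise norm, and this is where
  \<open>p \<le> 2\<close> enters: it follows from Jensen's inequality, applied to the squared moduli of the
  entries of the eigenvectors of \<open>C\<close>, and the subadditivity of \<open>t powr (p / 2)\<close>
  (\<open>sum_powr_eigenvalues_le_entries\<close>).

  Dividing by \<open>n\<close>, the left-hand side is the cost of an explicit coupling, which bounds the
  Wasserstein distance. The Stieltjes transforms are compared along the same matching, the function
  \<open>t \<mapsto> 1 / (z - t)\<close> being 1-Lipschitz on the real line for \<open>Im z \<ge> 2\<close>. Eigenvalues, counted with
  multiplicity as roots of the characteristic polynomial, are accessed through a spectral theorem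
  for Hermitian matrices (\<open>hermitian_spectral_resolution\<close>).\<close>

section \<open>Adjoints and unitary diagonalization\<close>

lemma index_mat_adjoint [simp]:
  fixes A :: "complex mat"
  assumes "i < dim_col A" "j < dim_row A"
  shows "mat_adjoint A $$ (i, j) = cnj (A $$ (j, i))"
  using assms by (simp add: mat_adjoint_def mat_of_rows_def)

lemma dim_mat_adjoint [simp]:
  "dim_row (mat_adjoint A) = dim_col A" "dim_col (mat_adjoint A) = dim_row A"
  by (simp_all add: mat_adjoint_def)

lemma mat_adjoint_carrier [simp]: "A \<in> carrier_mat m n \<Longrightarrow> mat_adjoint A \<in> carrier_mat n m"
  by (metis carrier_matD carrier_matI dim_mat_adjoint)

lemma mat_adjoint_mult:
  fixes A B :: "complex mat"
  assumes "A \<in> carrier_mat k m" "B \<in> carrier_mat m n"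
  shows "mat_adjoint (A * B) = mat_adjoint B * mat_adjoint A"
  using assms by (intro eq_matI) (auto simp: scalar_prod_def mult.commute)

lemma mat_adjoint_adjoint [simp]: "mat_adjoint (mat_adjoint A) = (A :: complex mat)"
  by (intro eq_matI) auto

lemma mat_adjoint_block_diag:
  fixes A D :: "complex mat"
  assumes "A \<in> carrier_mat m m" "D \<in> carrier_mat n n"
  shows "mat_adjoint (four_block_mat A (0\<^sub>m m n) (0\<^sub>m n m) D) =
    four_block_mat (mat_adjoint A) (0\<^sub>m m n) (0\<^sub>m n m) (mat_adjoint D)"
  using assms by (intro eq_matI) (auto split: if_splits)

text \<open>Any nonzero vector is, up to scaling, the first column of a unitary matrix: complete it to a
  basis, orthogonalize, and divide each column by its norm. This is the change of basis that splits
  off one eigenvector below.\<close>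

lemma unitary_with_first_column:
  fixes v :: "complex vec"
  assumes v: "v \<in> carrier_vec n" "v \<noteq> 0\<^sub>v n"
  obtains W c where "W \<in> carrier_mat n n" "mat_adjoint W * W = 1\<^sub>m n" "col W 0 = c \<cdot>\<^sub>v v"
proof -
  interpret cof_vec_space n "TYPE(complex)" .
  define b where "b = basis_completion v"
  define ws where "ws = gram_schmidt n b"
  note bc = basis_completion[OF v, folded b_def]
  have n: "n > 0" using v by (metis carrier_vecD eq_vecI index_zero_vec(2) neq0_conv not_less0)
  obtain vs where bv: "b = v # vs" using bc(6,7) n by (cases b) auto
  note gs = gram_schmidt_result[OF bc(2,4,5) ws_def]
  have len: "length ws = n" using gs bc(6) by simp
  have ws: "set ws \<subseteq> carrier_vec n" and orth: "corthogonal ws" using gs by auto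
  have dim: "ws ! j \<in> carrier_vec n" if "j < n" for j using ws len that by (meson nth_mem subsetD)
  have hd: "ws ! 0 = v" using gram_schmidt_hd[OF v(1), of vs, folded bv ws_def] len n
    by (cases ws) auto
  define r where "r j = sqrt (\<Sum>i<n. (cmod (ws ! j $ i))\<^sup>2)" for j
  have sp: "ws ! i \<bullet>c ws ! j = (\<Sum>k<n. ws ! i $ k * cnj (ws ! j $ k))" if "i < n" "j < n" for i j
    using dim[OF that(1)] dim[OF that(2)] by (auto simp: scalar_prod_def lessThan_atLeast0 intro!: sum.cong)
  have r2: "ws ! j \<bullet>c ws ! j = complex_of_real ((r j)\<^sup>2)" if "j < n" for j
    by (simp add: sp that r_def sum_nonneg complex_norm_square del: of_real_power)
  have r0: "r j \<noteq> 0" if "j < n" for j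
    using corthogonalD[OF orth, of j j] r2[OF that] that len by auto
  define W where "W = mat n n (\<lambda>(i, j). ws ! j $ i / complex_of_real (r j))"
  have W: "W \<in> carrier_mat n n" by (simp add: W_def)
  have "mat_adjoint W * W = 1\<^sub>m n"
  proof (rule eq_matI)
    fix i j assume "i < dim_row (1\<^sub>m n :: complex mat)" "j < dim_col (1\<^sub>m n :: complex mat)"
    hence ij: "i < n" "j < n" by auto
    have "(mat_adjoint W * W) $$ (i, j) =
        (\<Sum>k<n. ws ! j $ k * cnj (ws ! i $ k) / (complex_of_real (r i) * complex_of_real (r j)))"
      using ij W by (auto simp: scalar_prod_def lessThan_atLeast0 W_def mult_ac intro!: sum.cong)
    also have "\<dots> = (ws ! j \<bullet>c ws ! i) / (complex_of_real (r i) * complex_of_real (r j))"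
      by (simp add: sp ij sum_divide_distrib)
    also have "\<dots> = (if i = j then 1 else 0)"
      using corthogonalD[OF orth, of j i] r2[OF ij(1)] r0[OF ij(1)] ij len
      by (auto simp: power2_eq_square)
    finally show "(mat_adjoint W * W) $$ (i, j) = 1\<^sub>m n $$ (i, j)" using ij by simp
  qed (use W in auto)
  moreover have "col W 0 = (1 / complex_of_real (r 0)) \<cdot>\<^sub>v v"
    using n v(1) by (intro eq_vecI) (auto simp: W_def hd)
  ultimately show thesis using that W by blast
qed

text \<open>Change basis so that an eigenvector comes first. The first column of the transformed matrix
  \<open>C\<close> is then a multiple of the first unit vector and, \<open>C\<close> being self-adjoint, so is its first
  row; hence \<open>C\<close> is block diagonal and induction applies to the lower block. The order of the
  eigenvalues on the diagonal can be prescribed in advance, which later makes it possible to ask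
  for a monotone list.\<close>

lemma hermitian_unitary_diagonalization:
  fixes A :: "complex mat"
  assumes "A \<in> carrier_mat n n" "mat_adjoint A = A" "char_poly A = (\<Prod>e\<leftarrow>es. [:- e, 1:])"
  shows "\<exists>U\<in>carrier_mat n n. mat_adjoint U * U = 1\<^sub>m n \<and>
    mat_adjoint U * A * U = mat n n (\<lambda>(i, j). if i = j then es ! i else 0)"
  using assms
proof (induction es arbitrary: n A)
  case Nil
  hence n: "n = 0" using degree_monic_char_poly[OF Nil(1)] by simp
  show ?case by (intro bexI[of _ "1\<^sub>m n"] conjI eq_matI) (auto simp: n)
next
  case (Cons e es)
  note A = Cons.prems(1)
  have "length (e # es) = n"
    using degree_monic_char_poly[OF A] Cons.prems(3) degree_linear_factors[of uminus "e # es"] by simp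
  then obtain m where n: "n = Suc m" and m: "length es = m" by auto
  have "eigenvalue A e" unfolding eigenvalue_root_char_poly[OF A] Cons.prems(3) by simp
  then obtain v where ev: "eigenvector A v e" by (auto simp: eigenvalue_def)
  hence v: "v \<in> carrier_vec n" "v \<noteq> 0\<^sub>v n" "A *\<^sub>v v = e \<cdot>\<^sub>v v" using A by (auto simp: eigenvector_def)
  obtain W c where W: "W \<in> carrier_mat n n" "mat_adjoint W * W = 1\<^sub>m n" "col W 0 = c \<cdot>\<^sub>v v"
    using unitary_with_first_column[OF v(1,2)] .
  have W': "W * mat_adjoint W = 1\<^sub>m n"
    using mat_mult_left_right_inverse[OF _ W(1,2)] W(1) by simp
  define C where "C = mat_adjoint W * A * W"
  have C: "C \<in> carrier_mat n n" using W(1) A by (auto simp: C_def)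
  have herm: "mat_adjoint C = C"
    unfolding C_def using W(1) A Cons.prems(2)
    by (simp add: mat_adjoint_mult[of _ n n _ n] assoc_mult_mat[of _ n n _ n _ n])
  have col0: "C $$ (i, 0) = (if i = 0 then e else 0)" if "i < n" for i
  proof -
    have "col (A * W) 0 = A *\<^sub>v col W 0" using A W(1) n by (intro eq_vecI) auto
    also have "\<dots> = e \<cdot>\<^sub>v col W 0"
      using v A by (auto simp: W(3) mult_mat_vec[of _ n n] smult_smult_assoc mult.commute)
    finally have c: "col (A * W) 0 = e \<cdot>\<^sub>v col W 0" .
    have "C $$ (i, 0) = (mat_adjoint W * (A * W)) $$ (i, 0)"
      unfolding C_def using W(1) A by (simp add: assoc_mult_mat[of _ n n _ n _ n])
    also have "\<dots> = row (mat_adjoint W) i \<bullet> col (A * W) 0" using that n A W(1) by auto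
    also have "\<dots> = e * (row (mat_adjoint W) i \<bullet> col W 0)" unfolding c
      using W(1) that n by (intro scalar_prod_smult_right) auto
    also have "row (mat_adjoint W) i \<bullet> col W 0 = (mat_adjoint W * W) $$ (i, 0)"
      using that n W(1) by auto
    finally show ?thesis using that n W(2) by auto
  qed
  have row0: "C $$ (0, i) = (if i = 0 then e else 0)" if "0 < i" "i < n" for i
  proof -
    have "C $$ (0, i) = mat_adjoint C $$ (0, i)" by (simp add: herm)
    also have "\<dots> = cnj (C $$ (i, 0))" using that C n by (subst index_mat_adjoint) auto
    finally show ?thesis using col0[of i] that by simp
  qed
  define E where "E = mat 1 1 (\<lambda>_. e)"
  define D where "D = mat m m (\<lambda>(i, j). C $$ (Suc i, Suc j))"
  have E: "E \<in> carrier_mat 1 1" and D: "D \<in> carrier_mat m m" by (auto simp: E_def D_def)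
  have CB: "C = four_block_mat E (0\<^sub>m 1 m) (0\<^sub>m m 1) D"
    using C n row0 col0 by (intro eq_matI) (auto simp: E_def D_def)
  have hD: "mat_adjoint D = D"
  proof (rule eq_matI)
    fix i j assume "i < dim_row D" "j < dim_col D"
    hence ij: "i < m" "j < m" using D by auto
    have "C $$ (Suc i, Suc j) = mat_adjoint C $$ (Suc i, Suc j)" by (simp add: herm)
    also have "\<dots> = cnj (C $$ (Suc j, Suc i))" using ij C n by (subst index_mat_adjoint) auto
    finally show "mat_adjoint D $$ (i, j) = D $$ (i, j)" using ij by (simp add: D_def)
  qed (use D in auto)
  have "similar_mat_wit A C W (mat_adjoint W)"
  proof (rule similar_mat_witI[of _ _ n])
    have "W * C * mat_adjoint W = (W * mat_adjoint W) * A * (W * mat_adjoint W)"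
      unfolding C_def using W(1) A
      by (simp add: assoc_mult_mat[of _ n n _ n _ n] mult_carrier_mat[of _ n n _ n])
    also have "\<dots> = A" unfolding W' using A by simp
    finally show "A = W * C * mat_adjoint W" by simp
  qed (use W W' A C in auto)
  hence "char_poly A = char_poly C" by (intro char_poly_similar) (auto simp: similar_mat_def)
  also have "\<dots> = char_poly E * char_poly D"
    unfolding CB by (rule char_poly_four_block_zeros_col[OF E _ D]) simp
  also have "char_poly E = [:- e, 1:]" by (simp add: E_def char_poly_defs det_def sign_def)
  finally have "[:- e, 1:] * char_poly D = [:- e, 1:] * (\<Prod>e\<leftarrow>es. [:- e, 1:])"
    using Cons.prems(3) by simp
  hence "char_poly D = (\<Prod>e\<leftarrow>es. [:- e, 1:])" by (subst (asm) mult_cancel_left) simp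
  from Cons.IH[OF D hD this] obtain V where V: "V \<in> carrier_mat m m" "mat_adjoint V * V = 1\<^sub>m m"
    "mat_adjoint V * D * V = mat m m (\<lambda>(i, j). if i = j then es ! i else 0)" by blast
  define X where "X = four_block_mat (1\<^sub>m 1) (0\<^sub>m 1 m) (0\<^sub>m m 1) V"
  have X: "X \<in> carrier_mat n n" using V(1) n by (auto simp: X_def)
  have aone: "mat_adjoint (1\<^sub>m 1) = (1\<^sub>m 1 :: complex mat)" by (intro eq_matI) auto
  have aX: "mat_adjoint X = four_block_mat (1\<^sub>m 1) (0\<^sub>m 1 m) (0\<^sub>m m 1) (mat_adjoint V)"
    unfolding X_def using V(1) by (subst mat_adjoint_block_diag) (auto simp: aone)
  have XX: "mat_adjoint X * X = 1\<^sub>m n"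
    unfolding aX unfolding X_def using V(1)
    by (subst mult_four_block_mat[of _ 1 1 _ m _ m _ _ 1 _ m]) (auto simp: V(2) n)
  have XCX: "mat_adjoint X * C * X = mat n n (\<lambda>(i, j). if i = j then (e # es) ! i else 0)"
  proof -
    have XC: "mat_adjoint X * C = four_block_mat E (0\<^sub>m 1 m) (0\<^sub>m m 1) (mat_adjoint V * D)"
      unfolding aX CB using V(1) E D
      by (subst mult_four_block_mat[of _ 1 1 _ m _ m _ _ 1 _ m]) auto
    have VD: "mat_adjoint V * D \<in> carrier_mat m m" using V(1) D by auto
    have "mat_adjoint X * C * X =
        four_block_mat E (0\<^sub>m 1 m) (0\<^sub>m m 1) (mat_adjoint V * D * V)"
      unfolding XC unfolding X_def using V(1) E VD
      by (subst mult_four_block_mat[of _ 1 1 _ m _ m _ _ 1 _ m]) auto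
    thus ?thesis unfolding V(3) using n by (intro eq_matI) (auto simp: E_def nth_Cons')
  qed
  show ?case
  proof (intro bexI[of _ "W * X"] conjI)
    have "mat_adjoint (W * X) * (W * X) = mat_adjoint X * (mat_adjoint W * W) * X"
      using W(1) X by (simp add: mat_adjoint_mult[of _ n n _ n] assoc_mult_mat[of _ n n _ n _ n] mult_carrier_mat[of _ n n _ n])
    thus "mat_adjoint (W * X) * (W * X) = 1\<^sub>m n" using X by (simp add: W(2) XX)
    have "mat_adjoint (W * X) * A * (W * X) = mat_adjoint X * C * X"
      unfolding C_def using W(1) X A
      by (simp add: mat_adjoint_mult[of _ n n _ n] assoc_mult_mat[of _ n n _ n _ n] mult_carrier_mat[of _ n n _ n])
    thus "mat_adjoint (W * X) * A * (W * X) = mat n n (\<lambda>(i, j). if i = j then (e # es) ! i else 0)"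
      by (simp add: XCX)
  qed (use W(1) X in auto)
qed

section \<open>Spectral resolutions\<close>

text \<open>The decomposition \<open>A = \<Sum>\<^sub>k l\<^sub>k u\<^sub>k u\<^sub>k\<^sup>*\<close> in terms of entries: \<open>u k i\<close> is the \<open>i\<close>-th entry of the
  \<open>k\<close>-th eigenvector, the second clause says that these vectors are complete and the third that they
  are orthonormal. With matrices given by their entries, new Hermitian matrices can be written down
  as sums, and no dimension side conditions accumulate.\<close>

definition spectral_resolution ::
  "nat \<Rightarrow> (nat \<Rightarrow> nat \<Rightarrow> complex) \<Rightarrow> (nat \<Rightarrow> nat \<Rightarrow> complex) \<Rightarrow> (nat \<Rightarrow> real) \<Rightarrow> bool" where
  "spectral_resolution n a u l \<longleftrightarrow>
     (\<forall>i<n. \<forall>j<n. a i j = (\<Sum>k<n. complex_of_real (l k) * u k i * cnj (u k j))) \<and>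
     (\<forall>i<n. \<forall>j<n. (\<Sum>k<n. u k i * cnj (u k j)) = of_bool (i = j)) \<and>
     (\<forall>k<n. \<forall>m<n. (\<Sum>i<n. cnj (u k i) * u m i) = of_bool (k = m))"

definition nonincreasing :: "nat \<Rightarrow> (nat \<Rightarrow> real) \<Rightarrow> bool" where
  "nonincreasing n l \<longleftrightarrow> (\<forall>i j. i \<le> j \<longrightarrow> j < n \<longrightarrow> l j \<le> l i)"

definition hermitian_form :: "nat \<Rightarrow> (nat \<Rightarrow> nat \<Rightarrow> complex) \<Rightarrow> (nat \<Rightarrow> complex) \<Rightarrow> real" where
  "hermitian_form n a x = Re (\<Sum>i<n. \<Sum>j<n. cnj (x i) * a i j * x j)"

lemma prod_list_eq_prod_mset_image:
  "(\<Prod>e\<leftarrow>es. f e) = prod_mset (image_mset f (mset es))"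
  by (induction es) auto

text \<open>The roots reappear on the diagonal of a self-adjoint matrix.\<close>

lemma hermitian_char_poly_real_roots:
  fixes A :: "complex mat"
  assumes "A \<in> carrier_mat n n" "mat_adjoint A = A" "char_poly A = (\<Prod>e\<leftarrow>es. [:- e, 1:])"
    and "length es = n" "e \<in> set es"
  shows "e \<in> \<real>"
proof -
  obtain U where U: "U \<in> carrier_mat n n" "mat_adjoint U * U = 1\<^sub>m n"
    "mat_adjoint U * A * U = mat n n (\<lambda>(i, j). if i = j then es ! i else 0)"
    using hermitian_unitary_diagonalization[OF assms(1-3)] by blast
  obtain i where i: "i < n" "e = es ! i" using assms(4,5) by (metis in_set_conv_nth)
  define D where "D = mat_adjoint U * A * U"
  have "mat_adjoint D = D"
    unfolding D_def using U(1) assms(1,2)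
    by (simp add: mat_adjoint_mult[of _ n n _ n] assoc_mult_mat[of _ n n _ n _ n])
  moreover have "mat_adjoint D $$ (i, i) = cnj (D $$ (i, i))"
    using i U(1) by (subst index_mat_adjoint) (auto simp: D_def)
  moreover have "D $$ (i, i) = e" using i by (simp add: D_def U(3))
  ultimately show ?thesis by (simp add: Reals_cnj_iff)
qed

text \<open>Since all roots are real, they can be sorted, and the diagonalization is carried out a second
  time with the sorted list.\<close>

theorem hermitian_spectral_resolution:
  fixes A :: "complex mat"
  assumes A: "A \<in> carrier_mat n n" "mat_adjoint A = A"
  obtains u l where "spectral_resolution n (\<lambda>i j. A $$ (i, j)) u l" "nonincreasing n l"
    "eigenvalues_mset A = image_mset (\<lambda>i. complex_of_real (l i)) (mset_set {..<n})"
proof -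
  obtain es where es: "char_poly A = (\<Prod>e\<leftarrow>es. [:- e, 1:])" "length es = n"
    using char_poly_factorized[OF A(1)] by blast
  define rs where "rs = rev (sort (map Re es))"
  have len: "length rs = n" by (simp add: rs_def es)
  have "mset (map complex_of_real rs) = image_mset (\<lambda>e. complex_of_real (Re e)) (mset es)"
    by (simp add: rs_def multiset.map_comp o_def)
  also have "\<dots> = image_mset (\<lambda>e. e) (mset es)"
    using hermitian_char_poly_real_roots[OF A es] by (intro image_mset_cong) simp
  finally have ms: "mset (map complex_of_real rs) = mset es" by simp
  hence cp: "char_poly A = (\<Prod>e\<leftarrow>map complex_of_real rs. [:- e, 1:])"
    unfolding es(1) prod_list_eq_prod_mset_image by simp
  obtain U where U: "U \<in> carrier_mat n n" "mat_adjoint U * U = 1\<^sub>m n"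
    "mat_adjoint U * A * U = mat n n (\<lambda>(i, j). if i = j then map complex_of_real rs ! i else 0)"
    using hermitian_unitary_diagonalization[OF A cp] by blast
  have U': "U * mat_adjoint U = 1\<^sub>m n"
    using mat_mult_left_right_inverse[OF _ U(1,2)] U(1) by simp
  define D where "D = mat_adjoint U * A * U"
  have D: "D = mat n n (\<lambda>(i, j). if i = j then complex_of_real (rs ! i) else 0)"
    unfolding D_def U(3) using len by (intro eq_matI) auto
  have "U * D * mat_adjoint U = (U * mat_adjoint U) * A * (U * mat_adjoint U)"
    unfolding D_def using U(1) A
    by (simp add: assoc_mult_mat[of _ n n _ n _ n] mult_carrier_mat[of _ n n _ n])
  also have "\<dots> = A" unfolding U' using A by simp
  finally have UDU: "U * D * mat_adjoint U = A" .
  have UD: "(U * D) $$ (i, k) = complex_of_real (rs ! k) * U $$ (i, k)" if "i < n" "k < n" for i k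
  proof -
    have "(U * D) $$ (i, k) = (\<Sum>j<n. U $$ (i, j) * D $$ (j, k))"
      using U(1) D that by (auto simp: scalar_prod_def lessThan_atLeast0)
    also have "\<dots> = (\<Sum>j<n. if j = k then complex_of_real (rs ! k) * U $$ (i, k) else 0)"
      using that by (intro sum.cong) (auto simp: D)
    also have "\<dots> = complex_of_real (rs ! k) * U $$ (i, k)" using that by simp
    finally show ?thesis .
  qed
  have E1: "A $$ (i, j) = (\<Sum>k<n. complex_of_real (rs ! k) * U $$ (i, k) * cnj (U $$ (j, k)))"
    if "i < n" "j < n" for i j
  proof -
    have "A $$ (i, j) = (\<Sum>k<n. (U * D) $$ (i, k) * mat_adjoint U $$ (k, j))"
      using U(1) that by (subst UDU[symmetric]) (auto simp: scalar_prod_def lessThan_atLeast0 D)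
    thus ?thesis using U(1) that by (auto simp: UD intro!: sum.cong)
  qed
  have E2: "(\<Sum>k<n. U $$ (i, k) * cnj (U $$ (j, k))) = of_bool (i = j)" if "i < n" "j < n" for i j
  proof -
    have "(U * mat_adjoint U) $$ (i, j) = (\<Sum>k<n. U $$ (i, k) * cnj (U $$ (j, k)))"
      using U(1) that by (auto simp: scalar_prod_def lessThan_atLeast0 intro!: sum.cong)
    from this[symmetric] show ?thesis using that by (simp add: U')
  qed
  have E3: "(\<Sum>i<n. cnj (U $$ (i, k)) * U $$ (i, m)) = of_bool (k = m)" if "k < n" "m < n" for k m
  proof -
    have "(mat_adjoint U * U) $$ (k, m) = (\<Sum>i<n. cnj (U $$ (i, k)) * U $$ (i, m))"
      using U(1) that by (auto simp: scalar_prod_def lessThan_atLeast0 intro!: sum.cong)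
    from this[symmetric] show ?thesis using that by (simp add: U)
  qed
  have "spectral_resolution n (\<lambda>i j. A $$ (i, j)) (\<lambda>k i. U $$ (i, k)) (\<lambda>k. rs ! k)"
    unfolding spectral_resolution_def using E1 E2 E3 by blast
  moreover have "nonincreasing n (\<lambda>k. rs ! k)"
    unfolding nonincreasing_def rs_def
    using es(2) by (auto intro!: sorted_rev_nth_mono)
  moreover have "eigenvalues_mset A = image_mset (\<lambda>i. complex_of_real (rs ! i)) (mset_set {..<n})"
  proof -
    have "proots (\<Prod>e\<leftarrow>rs. [:- complex_of_real e, 1:]) = mset (map complex_of_real rs)" for rs
    proof (induction rs)
      case (Cons r rs)
      have "(\<Prod>e\<leftarrow>rs. [:- complex_of_real e, 1:]) \<noteq> 0" by (auto simp: prod_list_zero_iff)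
      with proots_mult[of "[:- complex_of_real r, 1:]"] show ?case
        using Cons by (simp del: mult_pCons_left)
    qed simp
    hence "eigenvalues_mset A = mset (map complex_of_real rs)"
      unfolding eigenvalues_mset_def cp by (simp add: o_def)
    also have "\<dots> = image_mset complex_of_real (image_mset (\<lambda>i. rs ! i) (mset_set {..<n}))"
      using len by (subst map_nth[of rs, symmetric]) (simp add: mset_upt lessThan_atLeast0 multiset.map_comp o_def)
    finally show ?thesis by (simp add: multiset.map_comp o_def)
  qed
  ultimately show thesis using that by blast
qed

context
  fixes n a u l
  assumes res: "spectral_resolution n a u l"
begin

lemma spectral_resolution_entry:
  "i < n \<Longrightarrow> j < n \<Longrightarrow> a i j = (\<Sum>k<n. complex_of_real (l k) * u k i * cnj (u k j))"
  using res by (simp add: spectral_resolution_def)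

lemma spectral_resolution_complete:
  "i < n \<Longrightarrow> j < n \<Longrightarrow> (\<Sum>k<n. u k i * cnj (u k j)) = of_bool (i = j)"
  using res by (simp add: spectral_resolution_def)

lemma spectral_resolution_orthonormal:
  "k < n \<Longrightarrow> m < n \<Longrightarrow> (\<Sum>i<n. cnj (u k i) * u m i) = of_bool (k = m)"
  using res by (simp add: spectral_resolution_def)

text \<open>Covers both the form of \<open>a\<close> (weights \<open>l\<close>) and the squared norm (weights \<open>1\<close>).\<close>

lemma weighted_quadratic_form:
  fixes c :: "nat \<Rightarrow> real"
  shows "(\<Sum>i<n. \<Sum>j<n. cnj (x i) * (\<Sum>k<n. complex_of_real (c k) * u k i * cnj (u k j)) * x j) =
    complex_of_real (\<Sum>k<n. c k * (cmod (\<Sum>i<n. cnj (u k i) * x i))\<^sup>2)"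
proof -
  have "(\<Sum>i<n. \<Sum>j<n. cnj (x i) * (\<Sum>k<n. complex_of_real (c k) * u k i * cnj (u k j)) * x j) =
     (\<Sum>i<n. \<Sum>j<n. \<Sum>k<n. complex_of_real (c k) * (cnj (x i) * u k i) * (cnj (u k j) * x j))"
    by (simp add: sum_distrib_left sum_distrib_right mult_ac)
  also have "\<dots> = (\<Sum>i<n. \<Sum>k<n. \<Sum>j<n. complex_of_real (c k) * (cnj (x i) * u k i) * (cnj (u k j) * x j))"
    by (intro sum.cong refl sum.swap)
  also have "\<dots> = (\<Sum>k<n. \<Sum>i<n. \<Sum>j<n. complex_of_real (c k) * (cnj (x i) * u k i) * (cnj (u k j) * x j))"
    by (rule sum.swap)
  also have "\<dots> = (\<Sum>k<n. complex_of_real (c k) *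
      ((\<Sum>i<n. cnj (u k i) * x i) * cnj (\<Sum>i<n. cnj (u k i) * x i)))"
    by (simp add: sum_product sum_distrib_left mult_ac)
  also have "\<dots> = complex_of_real (\<Sum>k<n. c k * (cmod (\<Sum>i<n. cnj (u k i) * x i))\<^sup>2)"
    by (simp only: complex_norm_square[symmetric] of_real_mult[symmetric] of_real_sum[symmetric])
  finally show ?thesis .
qed

lemma hermitian_form_diagonal:
  "hermitian_form n a x = (\<Sum>k<n. l k * (cmod (\<Sum>i<n. cnj (u k i) * x i))\<^sup>2)"
proof -
  have "(\<Sum>i<n. \<Sum>j<n. cnj (x i) * a i j * x j) =
    (\<Sum>i<n. \<Sum>j<n. cnj (x i) * (\<Sum>k<n. complex_of_real (l k) * u k i * cnj (u k j)) * x j)"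
    by (intro sum.cong refl) (simp add: spectral_resolution_entry)
  thus ?thesis unfolding hermitian_form_def weighted_quadratic_form by simp
qed

lemma parseval: "(\<Sum>i<n. (cmod (x i))\<^sup>2) = (\<Sum>k<n. (cmod (\<Sum>i<n. cnj (u k i) * x i))\<^sup>2)"
proof -
  have "complex_of_real (\<Sum>k<n. (cmod (\<Sum>i<n. cnj (u k i) * x i))\<^sup>2) =
      (\<Sum>i<n. \<Sum>j<n. cnj (x i) * (\<Sum>k<n. u k i * cnj (u k j)) * x j)"
    using weighted_quadratic_form[of x "\<lambda>_. 1"] by simp
  also have "\<dots> = (\<Sum>i<n. \<Sum>j<n. if j = i then cnj (x i) * x i else 0)"
    by (intro sum.cong refl) (auto simp: spectral_resolution_complete)
  also have "\<dots> = (\<Sum>i<n. complex_of_real ((cmod (x i))\<^sup>2))"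
    by (intro sum.cong refl) (simp add: complex_norm_square mult.commute del: of_real_power)
  also have "\<dots> = complex_of_real (\<Sum>i<n. (cmod (x i))\<^sup>2)" by simp
  finally show ?thesis by (simp only: of_real_eq_iff)
qed

lemma trace_eq_sum_eigenvalues: "(\<Sum>i<n. a i i) = complex_of_real (\<Sum>k<n. l k)"
proof -
  have "(\<Sum>i<n. a i i) = (\<Sum>i<n. \<Sum>k<n. complex_of_real (l k) * (cnj (u k i) * u k i))"
    by (intro sum.cong refl) (simp add: spectral_resolution_entry mult_ac)
  also have "\<dots> = (\<Sum>k<n. complex_of_real (l k) * (\<Sum>i<n. cnj (u k i) * u k i))"
    by (subst sum.swap) (simp add: sum_distrib_left)
  also have "\<dots> = complex_of_real (\<Sum>k<n. l k)"
    by (simp add: spectral_resolution_orthonormal)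
  finally show ?thesis .
qed

end

text \<open>Let \<open>x \<noteq> 0\<close> be orthogonal to the eigenvectors of \<open>a\<close> with index above \<open>i\<close> and to those of \<open>d\<close>
  with index below \<open>i\<close>. The form of \<open>a\<close> at \<open>x\<close> is at least \<open>l i * |x|\<^sup>2\<close>, that of \<open>d\<close> at most
  \<open>m i * |x|\<^sup>2\<close>, and the comparison of the forms gives the claim. Such an \<open>x\<close> exists because it has
  to satisfy only \<open>n - 1\<close> linear equations.\<close>

lemma weyl_monotonicity:
  assumes ra: "spectral_resolution n a u l" and rd: "spectral_resolution n d w m"
    and l: "nonincreasing n l" and m: "nonincreasing n m"
    and le: "\<And>x. hermitian_form n a x + s * (\<Sum>i<n. (cmod (x i))\<^sup>2) \<le> hermitian_form n d x"
    and i: "i < n"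
  shows "l i + s \<le> m i"
proof -
  \<comment> \<open>The \<open>n - 1\<close> equations, with a zero row in place \<open>i\<close> to make the system square and singular.\<close>
  define M where "M = mat n n (\<lambda>(r, j). if r < i then cnj (w r j) else if r = i then 0 else cnj (u r j))"
  have M: "M \<in> carrier_mat n n" by (simp add: M_def)
  have M_rows: "M = mat\<^sub>r n n (\<lambda>r. if r = i then 0\<^sub>v n else row M r)"
    using i by (intro eq_matI) (auto simp: M_def)
  have "det M = 0"
    by (subst M_rows) (rule det_row_0[OF i], auto simp: M_def)
  then obtain v where v: "v \<in> carrier_vec n" "v \<noteq> 0\<^sub>v n" "M *\<^sub>v v = 0\<^sub>v n"
    using det_0_iff_vec_prod_zero[OF M] by blast
  have Mv: "(\<Sum>j<n. M $$ (r, j) * v $ j) = 0" if "r < n" for r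
  proof -
    have "(M *\<^sub>v v) $ r = (\<Sum>j<n. M $$ (r, j) * v $ j)"
      using M v(1) that by (auto simp: scalar_prod_def lessThan_atLeast0)
    thus ?thesis using v(3) that by simp
  qed
  define x where "x j = v $ j" for j
  define N where "N = (\<Sum>j<n. (cmod (x j))\<^sup>2)"
  have w0: "(\<Sum>j<n. cnj (w r j) * x j) = 0" if "r < i" for r
    using Mv[of r] that i by (simp add: M_def x_def)
  have u0: "(\<Sum>j<n. cnj (u r j) * x j) = 0" if "i < r" "r < n" for r
    using Mv[of r] that i by (simp add: M_def x_def)
  obtain j where "j < n" "v $ j \<noteq> 0" using v(1,2) by (metis carrier_vecD eq_vecI index_zero_vec)
  hence N: "N > 0" unfolding N_def by (intro sum_pos2[of _ j]) (auto simp: x_def)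
  note N_ra = parseval[OF ra, of x, folded N_def] and N_rd = parseval[OF rd, of x, folded N_def]
  have "l i * N \<le> hermitian_form n a x"
    unfolding hermitian_form_diagonal[OF ra] N_ra sum_distrib_left
  proof (intro sum_mono)
    fix k assume "k \<in> {..<n}"
    thus "l i * (cmod (\<Sum>i<n. cnj (u k i) * x i))\<^sup>2 \<le> l k * (cmod (\<Sum>i<n. cnj (u k i) * x i))\<^sup>2"
      using l i u0[of k] by (cases "i < k") (auto simp: nonincreasing_def intro!: mult_right_mono)
  qed
  moreover have "hermitian_form n d x \<le> m i * N"
    unfolding hermitian_form_diagonal[OF rd] N_rd sum_distrib_left
  proof (intro sum_mono)
    fix k assume "k \<in> {..<n}"
    thus "m k * (cmod (\<Sum>i<n. cnj (w k i) * x i))\<^sup>2 \<le> m i * (cmod (\<Sum>i<n. cnj (w k i) * x i))\<^sup>2"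
      using m i w0[of k] by (cases "k < i") (auto simp: nonincreasing_def intro!: mult_right_mono)
  qed
  moreover have "hermitian_form n a x + s * N \<le> hermitian_form n d x"
    unfolding N_def by (rule le)
  ultimately have "(l i + s) * N \<le> m i * N" by (simp add: distrib_right)
  thus ?thesis using N by simp
qed

section \<open>Eigenvalues of a difference\<close>

lemma spectral_resolution_hermitian:
  assumes "spectral_resolution n a u l" "i < n" "j < n"
  shows "a j i = cnj (a i j)"
  using assms by (simp add: spectral_resolution_entry mult_ac)

lemma spectral_resolution_cong:
  assumes "spectral_resolution n a u l" "\<And>i j. i < n \<Longrightarrow> j < n \<Longrightarrow> b i j = a i j"
  shows "spectral_resolution n b u l"
  unfolding spectral_resolution_def
  using assms(2) by (simp add: spectral_resolution_entry[OF assms(1)]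
    spectral_resolution_complete[OF assms(1)] spectral_resolution_orthonormal[OF assms(1)])

lemma spectral_resolution_exists:
  assumes "\<And>i j. i < n \<Longrightarrow> j < n \<Longrightarrow> a j i = cnj (a i j)"
  obtains u l where "spectral_resolution n a u l" "nonincreasing n l"
proof -
  define A where "A = mat n n (\<lambda>(i, j). a i j)"
  have A: "A \<in> carrier_mat n n" by (simp add: A_def)
  have "mat_adjoint A = A"
  proof (rule eq_matI)
    fix i j assume "i < dim_row A" "j < dim_col A"
    thus "mat_adjoint A $$ (i, j) = A $$ (i, j)" using assms[of j i] by (simp add: A_def)
  qed (simp_all add: A_def)
  then obtain u l where ul: "spectral_resolution n (\<lambda>i j. A $$ (i, j)) u l" "nonincreasing n l"
    by (rule hermitian_spectral_resolution[OF A])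
  have "spectral_resolution n a u l" by (rule spectral_resolution_cong[OF ul(1)]) (simp add: A_def)
  thus thesis using that ul(2) by blast
qed

lemma hermitian_form_add:
  "hermitian_form n (\<lambda>i j. a i j + b i j) x = hermitian_form n a x + hermitian_form n b x"
  by (simp add: hermitian_form_def algebra_simps sum.distrib)

lemma hermitian_form_scalar:
  "hermitian_form n (\<lambda>i j. if i = j then complex_of_real s else 0) x = s * (\<Sum>i<n. (cmod (x i))\<^sup>2)"
proof -
  have "(\<Sum>i<n. \<Sum>j<n. cnj (x i) * (if i = j then complex_of_real s else 0) * x j) =
      (\<Sum>i<n. \<Sum>j<n. if j = i then complex_of_real s * (x i * cnj (x i)) else 0)"
    by (intro sum.cong refl) auto
  also have "\<dots> = complex_of_real (s * (\<Sum>i<n. (cmod (x i))\<^sup>2))"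
    by (simp add: complex_norm_square[symmetric] sum_distrib_left del: of_real_power)
  finally show ?thesis by (simp add: hermitian_form_def)
qed

text \<open>Let \<open>c = a - b\<close> and let \<open>p\<close> be the positive part of \<open>c - s\<close>. Then \<open>d = b + s + p\<close> dominates both
  \<open>a\<close> and \<open>b + s\<close>, so by monotonicity its eigenvalues satisfy \<open>\<delta> i \<ge> \<alpha> i\<close> and \<open>\<delta> i \<ge> \<beta> i + s\<close>. Thus
  each term on the left is at most \<open>\<delta> i - (\<beta> i + s)\<close>, and these differences add up to the trace of
  \<open>p\<close>, which is the right-hand side.\<close>

lemma sum_excess_eigenvalue_differences_le:
  assumes ra: "spectral_resolution n a u \<alpha>" and rb: "spectral_resolution n b v \<beta>"
    and \<alpha>: "nonincreasing n \<alpha>" and \<beta>: "nonincreasing n \<beta>"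
    and rc: "spectral_resolution n (\<lambda>i j. a i j - b i j) w \<gamma>"
  shows "(\<Sum>i<n. max 0 (\<alpha> i - \<beta> i - s)) \<le> (\<Sum>i<n. max 0 (\<gamma> i - s))"
proof -
  define p where "p i j = (\<Sum>k<n. complex_of_real (max 0 (\<gamma> k - s)) * w k i * cnj (w k j))" for i j
  define e where "e i j = b i j + (if i = j then complex_of_real s else 0)" for i j :: nat
  define d where "d i j = e i j + p i j" for i j
  have rp: "spectral_resolution n p w (\<lambda>k. max 0 (\<gamma> k - s))"
    using rc by (simp add: spectral_resolution_def p_def)
  have "d j i = cnj (d i j)" if "i < n" "j < n" for i j
    using spectral_resolution_hermitian[OF rb that] spectral_resolution_hermitian[OF rp that]
    by (simp add: d_def e_def)
  then obtain z \<delta> where rd: "spectral_resolution n d z \<delta>" and \<delta>: "nonincreasing n \<delta>"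
    by (rule spectral_resolution_exists)
  have form_a: "hermitian_form n a x = hermitian_form n b x +
      (\<Sum>k<n. \<gamma> k * (cmod (\<Sum>i<n. cnj (w k i) * x i))\<^sup>2)" for x
    using hermitian_form_add[of n b "\<lambda>i j. a i j - b i j" x] hermitian_form_diagonal[OF rc, of x] by simp
  have form_d: "hermitian_form n d x = hermitian_form n b x + s * (\<Sum>i<n. (cmod (x i))\<^sup>2) +
      (\<Sum>k<n. max 0 (\<gamma> k - s) * (cmod (\<Sum>i<n. cnj (w k i) * x i))\<^sup>2)" for x
    unfolding d_def hermitian_form_add hermitian_form_diagonal[OF rp]
    unfolding e_def hermitian_form_add hermitian_form_scalar ..
  have \<alpha>\<delta>: "\<alpha> i \<le> \<delta> i" if "i < n" for i
  proof -
    have "hermitian_form n a x \<le> hermitian_form n d x" for x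
    proof -
      have "(\<Sum>k<n. \<gamma> k * (cmod (\<Sum>i<n. cnj (w k i) * x i))\<^sup>2) \<le>
          (\<Sum>k<n. (s + max 0 (\<gamma> k - s)) * (cmod (\<Sum>i<n. cnj (w k i) * x i))\<^sup>2)"
        by (intro sum_mono mult_right_mono) auto
      thus ?thesis
        unfolding form_a form_d parseval[OF rc, of x] by (simp add: distrib_right sum.distrib sum_distrib_left)
    qed
    thus ?thesis using weyl_monotonicity[OF ra rd \<alpha> \<delta>, of 0 i] that by simp
  qed
  have \<beta>\<delta>: "\<beta> i + s \<le> \<delta> i" if "i < n" for i
    by (rule weyl_monotonicity[OF rb rd \<beta> \<delta> _ that]) (auto simp: form_d intro!: sum_nonneg)
  have "(\<Sum>i<n. max 0 (\<alpha> i - \<beta> i - s)) \<le> (\<Sum>i<n. \<delta> i - (\<beta> i + s))"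
    using \<alpha>\<delta> \<beta>\<delta> by (intro sum_mono) (fastforce simp: max_def)
  also have "complex_of_real \<dots> = complex_of_real (\<Sum>i<n. max 0 (\<gamma> i - s))"
  proof -
    have "complex_of_real (\<Sum>i<n. \<delta> i - (\<beta> i + s)) =
        (\<Sum>i<n. d i i) - ((\<Sum>i<n. b i i) + (\<Sum>i<n. complex_of_real s))"
      unfolding trace_eq_sum_eigenvalues[OF rd] trace_eq_sum_eigenvalues[OF rb]
      by (simp add: sum_subtractf sum.distrib)
    also have "\<dots> = (\<Sum>i<n. p i i)" by (simp add: d_def e_def sum.distrib)
    finally show ?thesis unfolding trace_eq_sum_eigenvalues[OF rp] .
  qed
  hence "(\<Sum>i<n. \<delta> i - (\<beta> i + s)) = (\<Sum>i<n. max 0 (\<gamma> i - s))" by (simp only: of_real_eq_iff)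
  finally show ?thesis .
qed

text \<open>This represents \<open>x powr p\<close> as a mixture, with nonnegative weights, of the excesses of \<open>x\<close> over the
  thresholds \<open>s\<close>; it is Taylor's formula with integral remainder at \<open>0\<close>.\<close>

lemma powr_has_integral_excess:
  fixes p x R :: real
  assumes "1 < p" "0 \<le> x" "x \<le> R"
  shows "((\<lambda>s. p * (p - 1) * s powr (p - 2) * max 0 (x - s)) has_integral x powr p) {0..R}"
proof -
  \<comment> \<open>An antiderivative on the part of the interval where \<open>s < x\<close>. For \<open>p < 2\<close> the integrand is
    singular at \<open>0\<close>, but \<open>F\<close> is continuous there.\<close>
  define F where "F s = p * x * s powr (p - 1) - (p - 1) * s powr p" for s
  have "((\<lambda>s. p * (p - 1) * s powr (p - 2) * max 0 (x - s)) has_integral (F x - F 0)) {0..x}"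
  proof (rule fundamental_theorem_of_calculus_interior[OF assms(2)])
    show "continuous_on {0..x} F"
      unfolding F_def using assms by (intro continuous_intros continuous_on_powr') auto
    fix s assume s: "s \<in> {0<..<x}"
    have "(F has_real_derivative p * x * ((p - 1) * s powr (p - 1 - 1)) - (p - 1) * (p * s powr (p - 1))) (at s)"
      unfolding F_def using s by (auto intro!: derivative_eq_intros)
    moreover have "s powr (p - 1) = s * s powr (p - 2)"
      using s powr_add[of s 1 "p - 2"] by simp
    hence "p * x * ((p - 1) * s powr (p - 1 - 1)) - (p - 1) * (p * s powr (p - 1)) =
        p * (p - 1) * s powr (p - 2) * max 0 (x - s)"
      using s by (simp add: algebra_simps)
    ultimately show "(F has_vector_derivative p * (p - 1) * s powr (p - 2) * max 0 (x - s)) (at s)"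
      by (simp add: has_real_derivative_iff_has_vector_derivative)
  qed
  moreover have "F x - F 0 = x powr p"
  proof (cases "x = 0")
    case False
    hence "x * x powr (p - 1) = x powr p" using assms powr_add[of x 1 "p - 1"] by simp
    hence "F x = p * (x powr p) - (p - 1) * x powr p" by (simp add: F_def mult.assoc)
    thus ?thesis using assms by (simp add: F_def algebra_simps)
  qed simp
  moreover have "((\<lambda>s. p * (p - 1) * s powr (p - 2) * max 0 (x - s)) has_integral 0) {x..R}"
    by (rule has_integral_is_0) auto
  ultimately show ?thesis
    using has_integral_combine[of 0 x R _ "x powr p" 0] assms by simp
qed

text \<open>Integrate the hypothesis against the weight \<open>p * (p - 1) * s powr (p - 2)\<close>. For \<open>p = 1\<close> that
  weight degenerates to a point mass at \<open>0\<close>, so this case is the hypothesis for \<open>s = 0\<close>.\<close>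

lemma sum_powr_le_of_excess_le:
  fixes x y :: "nat \<Rightarrow> real"
  assumes "1 \<le> p" "\<And>i. i < n \<Longrightarrow> 0 \<le> x i" "\<And>i. i < n \<Longrightarrow> 0 \<le> y i"
    and excess: "\<And>s. 0 \<le> s \<Longrightarrow> (\<Sum>i<n. max 0 (x i - s)) \<le> (\<Sum>i<n. max 0 (y i - s))"
  shows "(\<Sum>i<n. x i powr p) \<le> (\<Sum>i<n. y i powr p)"
proof (cases "p = 1")
  case True
  thus ?thesis using excess[of 0] assms(2,3) by simp
next
  case False
  hence p: "1 < p" using assms(1) by simp
  define R where "R = (\<Sum>i<n. x i) + (\<Sum>i<n. y i)"
  have "x i \<le> (\<Sum>i<n. x i)" "y i \<le> (\<Sum>i<n. y i)" "0 \<le> (\<Sum>i<n. x i)" "0 \<le> (\<Sum>i<n. y i)" if "i < n" for i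
    using assms(2,3) that by (auto intro!: member_le_sum sum_nonneg)
  hence R: "x i \<le> R" "y i \<le> R" if "i < n" for i
    using that by (force simp: R_def)+
  have "((\<lambda>s. \<Sum>i<n. p * (p - 1) * s powr (p - 2) * max 0 (x i - s)) has_integral (\<Sum>i<n. x i powr p)) {0..R}"
    using p assms(2) R by (intro has_integral_sum powr_has_integral_excess) auto
  moreover have "((\<lambda>s. \<Sum>i<n. p * (p - 1) * s powr (p - 2) * max 0 (y i - s)) has_integral (\<Sum>i<n. y i powr p)) {0..R}"
    using p assms(3) R by (intro has_integral_sum powr_has_integral_excess) auto
  ultimately show ?thesis
  proof (rule has_integral_le)
    fix s assume "s \<in> {0..R}"
    thus "(\<Sum>i<n. p * (p - 1) * s powr (p - 2) * max 0 (x i - s)) \<le> (\<Sum>i<n. p * (p - 1) * s powr (p - 2) * max 0 (y i - s))"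
      unfolding sum_distrib_left[symmetric] using p excess by (intro mult_left_mono) auto
  qed
qed

text \<open>Above a threshold \<open>s \<ge> 0\<close>, the excess of an absolute value is the excess of the number plus
  that of its negative. Applying the excess inequality to the pair \<open>a\<close>, \<open>b\<close> and to the exchanged pair
  therefore controls the excesses of \<open>|\<alpha> i - \<beta> i|\<close>.\<close>

theorem sum_powr_eigenvalue_differences_le:
  assumes ra: "spectral_resolution n a u \<alpha>" and rb: "spectral_resolution n b v \<beta>"
    and \<alpha>: "nonincreasing n \<alpha>" and \<beta>: "nonincreasing n \<beta>"
    and rc: "spectral_resolution n (\<lambda>i j. a i j - b i j) w \<gamma>" and p: "1 \<le> p"
  shows "(\<Sum>i<n. \<bar>\<alpha> i - \<beta> i\<bar> powr p) \<le> (\<Sum>i<n. \<bar>\<gamma> i\<bar> powr p)"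
proof (rule sum_powr_le_of_excess_le[OF p])
  fix s :: real assume "0 \<le> s"
  have split: "(\<Sum>i<n. max 0 (\<bar>f i\<bar> - s)) = (\<Sum>i<n. max 0 (f i - s)) + (\<Sum>i<n. max 0 (- f i - s))"
    for f :: "nat \<Rightarrow> real"
    unfolding sum.distrib[symmetric] using \<open>0 \<le> s\<close> by (intro sum.cong) (auto simp: max_def abs_if)
  have "spectral_resolution n (\<lambda>i j. b i j - a i j) w (\<lambda>k. - \<gamma> k)"
    unfolding spectral_resolution_def
  proof (intro conjI allI impI)
    fix i j assume "i < n" "j < n"
    hence "a i j - b i j = (\<Sum>k<n. complex_of_real (\<gamma> k) * w k i * cnj (w k j))"
      using spectral_resolution_entry[OF rc] by simp
    moreover have "b i j - a i j = - (a i j - b i j)" by simp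
    ultimately show "b i j - a i j = (\<Sum>k<n. complex_of_real (- \<gamma> k) * w k i * cnj (w k j))"
      by (simp add: sum_negf)
  qed (use rc in \<open>auto simp: spectral_resolution_def\<close>)
  from sum_excess_eigenvalue_differences_le[OF rb ra \<beta> \<alpha> this, of s]
  have "(\<Sum>i<n. max 0 (- (\<alpha> i - \<beta> i) - s)) \<le> (\<Sum>i<n. max 0 (- \<gamma> i - s))" by simp
  thus "(\<Sum>i<n. max 0 (\<bar>\<alpha> i - \<beta> i\<bar> - s)) \<le> (\<Sum>i<n. max 0 (\<bar>\<gamma> i\<bar> - s))"
    unfolding split using sum_excess_eigenvalue_differences_le[OF ra rb \<alpha> \<beta> rc, of s] by linarith
qed auto

section \<open>From eigenvalues to entries\<close>

lemma powr_convex_tangent: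
  fixes q t y :: real
  assumes "1 \<le> q" "0 < t" "0 \<le> y"
  shows "t powr q + q * t powr (q - 1) * (y - t) \<le> y powr q"
proof (cases "y = 0")
  case True
  have "t powr q = t powr (q - 1) * t" using assms powr_add[of t "q - 1" 1] by simp
  moreover have "0 \<le> (q - 1) * (t powr (q - 1) * t)" using assms by simp
  ultimately show ?thesis using True assms by (simp add: algebra_simps)
next
  case False
  have "((\<lambda>x. x powr q) has_real_derivative q * t powr (q - 1)) (at t within {0<..})"
    using assms by (auto intro!: derivative_eq_intros)
  from convex_on_imp_above_tangent[OF powr_convex[OF assms(1)] _ _ _ this, of y]
  show ?thesis using assms False by (simp add: interior_open)
qed

text \<open>Average the tangent inequality at the mean \<open>t\<close> of the \<open>y i\<close>: the linear terms cancel. Tangents at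
  \<open>t > 0\<close> also lie below the graph at \<open>0\<close>, so some of the \<open>y i\<close> may vanish.\<close>

lemma powr_jensen:
  fixes c y :: "nat \<Rightarrow> real"
  assumes "1 \<le> q" "\<And>i. i < n \<Longrightarrow> 0 \<le> c i" "(\<Sum>i<n. c i) = 1" "\<And>i. i < n \<Longrightarrow> 0 \<le> y i"
  shows "(\<Sum>i<n. c i * y i) powr q \<le> (\<Sum>i<n. c i * y i powr q)"
proof -
  define t where "t = (\<Sum>i<n. c i * y i)"
  have "t \<ge> 0" unfolding t_def using assms by (intro sum_nonneg) auto
  show ?thesis
  proof (cases "t = 0")
    case True
    have "0 \<le> (\<Sum>i<n. c i * y i powr q)" using assms by (intro sum_nonneg) auto
    thus ?thesis using True by (simp add: t_def)
  next
    case False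
    have "t powr q = (\<Sum>i<n. c i * (t powr q + q * t powr (q - 1) * (y i - t)))"
    proof -
      have "(\<Sum>i<n. c i * (t powr q + q * t powr (q - 1) * (y i - t))) =
          (\<Sum>i<n. c i) * t powr q + q * t powr (q - 1) * ((\<Sum>i<n. c i * y i) - (\<Sum>i<n. c i) * t)"
        by (simp add: algebra_simps sum.distrib sum_subtractf sum_distrib_left sum_distrib_right)
      thus ?thesis by (simp add: assms(3) t_def)
    qed
    also have "\<dots> \<le> (\<Sum>i<n. c i * y i powr q)"
      using assms False \<open>t \<ge> 0\<close> by (intro sum_mono mult_left_mono powr_convex_tangent) auto
    finally show ?thesis by (simp add: t_def)
  qed
qed

text \<open>With \<open>S\<close> the sum of the \<open>z i\<close>, each term satisfies \<open>z i powr q \<ge> z i * S powr (q - 1)\<close>, because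
  \<open>z i \<le> S\<close> and the exponent \<open>q - 1\<close> is not positive.\<close>

lemma powr_sum_le_sum_powr:
  fixes z :: "nat \<Rightarrow> real"
  assumes "0 < q" "q \<le> 1" "\<And>i. i < n \<Longrightarrow> 0 \<le> z i"
  shows "(\<Sum>i<n. z i) powr q \<le> (\<Sum>i<n. z i powr q)"
proof -
  define S where "S = (\<Sum>i<n. z i)"
  have "S \<ge> 0" unfolding S_def using assms by (intro sum_nonneg) auto
  show ?thesis
  proof (cases "S = 0")
    case True
    thus ?thesis using sum_nonneg[of "{..<n}" "\<lambda>i. z i powr q"] by (simp add: S_def)
  next
    case False
    hence S: "S > 0" using \<open>S \<ge> 0\<close> by simp
    have "z i * S powr (q - 1) \<le> z i powr q" if "i < n" for i
    proof (cases "z i = 0")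
      case False
      hence z: "z i > 0" using assms(3)[OF that] by simp
      have "z i \<le> S" unfolding S_def using assms(3) that by (intro member_le_sum) auto
      hence "S powr (q - 1) \<le> z i powr (q - 1)" using assms z by (intro powr_mono2') auto
      hence "z i * S powr (q - 1) \<le> z i * z i powr (q - 1)" using z by simp
      also have "\<dots> = z i powr q" using z powr_add[of "z i" 1 "q - 1"] by simp
      finally show ?thesis .
    qed simp
    hence "(\<Sum>i<n. z i * S powr (q - 1)) \<le> (\<Sum>i<n. z i powr q)" by (intro sum_mono) auto
    moreover have "(\<Sum>i<n. z i * S powr (q - 1)) = S powr q"
      using S powr_add[of S 1 "q - 1"] by (simp add: sum_distrib_right[symmetric] S_def)
    ultimately show ?thesis by (simp add: S_def)
  qed
qed

text \<open>The numbers \<open>|w k i|\<^sup>2\<close> form a doubly stochastic matrix. Summing first over \<open>i\<close>, the left-hand side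
  is the sum over \<open>i\<close> of the averages of \<open>|\<gamma> k| powr p\<close> with weights \<open>|w k i|\<^sup>2\<close>. As \<open>2 / p \<ge> 1\<close>, Jensen's
  inequality bounds such an average by the \<open>p / 2\<close>-th power of the average of the \<open>\<gamma> k\<^sup>2\<close>, which is the
  squared Euclidean norm of the \<open>i\<close>-th row of \<open>c\<close>. Since \<open>p / 2 \<le> 1\<close>, the power may be
  distributed over the entries of the row. Both estimates use \<open>p \<le> 2\<close>.\<close>

lemma sum_powr_eigenvalues_le_entries:
  assumes rc: "spectral_resolution n c w \<gamma>" and p: "1 \<le> p" "p \<le> 2"
  shows "(\<Sum>k<n. \<bar>\<gamma> k\<bar> powr p) \<le> (\<Sum>i<n. \<Sum>j<n. cmod (c i j) powr p)"
proof -
  have unit_row: "(\<Sum>k<n. (cmod (w k i))\<^sup>2) = 1" if "i < n" for i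
  proof -
    have "complex_of_real (\<Sum>k<n. (cmod (w k i))\<^sup>2) = (\<Sum>k<n. w k i * cnj (w k i))"
      by (simp add: complex_norm_square del: of_real_power)
    thus ?thesis using spectral_resolution_complete[OF rc that that] by (simp del: of_real_sum)
  qed
  have unit_vec: "(\<Sum>i<n. (cmod (w k i))\<^sup>2) = 1" if "k < n" for k
  proof -
    have "complex_of_real (\<Sum>i<n. (cmod (w k i))\<^sup>2) = (\<Sum>i<n. cnj (w k i) * w k i)"
      by (simp add: complex_norm_square mult.commute del: of_real_power)
    thus ?thesis using spectral_resolution_orthonormal[OF rc that that] by (simp del: of_real_sum)
  qed
  have eigvec: "(\<Sum>j<n. cnj (w k j) * c j i) = complex_of_real (\<gamma> k) * cnj (w k i)"
    if "i < n" "k < n" for i k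
  proof -
    have "(\<Sum>j<n. cnj (w k j) * c j i) =
        (\<Sum>j<n. \<Sum>m<n. complex_of_real (\<gamma> m) * cnj (w m i) * (cnj (w k j) * w m j))"
      using that by (intro sum.cong refl) (simp add: spectral_resolution_entry[OF rc] sum_distrib_left mult_ac)
    also have "\<dots> = (\<Sum>m<n. complex_of_real (\<gamma> m) * cnj (w m i) * (\<Sum>j<n. cnj (w k j) * w m j))"
      by (subst sum.swap) (simp add: sum_distrib_left)
    also have "\<dots> = (\<Sum>m<n. if m = k then complex_of_real (\<gamma> k) * cnj (w k i) else 0)"
      using that by (intro sum.cong refl) (auto simp: spectral_resolution_orthonormal[OF rc])
    finally show ?thesis using that by simp
  qed
  have row: "(\<Sum>k<n. (cmod (w k i))\<^sup>2 * \<bar>\<gamma> k\<bar> powr p) \<le> (\<Sum>j<n. cmod (c i j) powr p)" if i: "i < n" for i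
  proof -
    define T where "T = (\<Sum>k<n. (cmod (w k i))\<^sup>2 * \<bar>\<gamma> k\<bar> powr p)"
    have T: "T \<ge> 0" unfolding T_def by (intro sum_nonneg) auto
    have "T powr (2 / p) \<le> (\<Sum>k<n. (cmod (w k i))\<^sup>2 * (\<bar>\<gamma> k\<bar> powr p) powr (2 / p))"
      unfolding T_def using p unit_row[OF i] by (intro powr_jensen) auto
    also have "\<dots> = (\<Sum>k<n. (cmod (\<Sum>j<n. cnj (w k j) * c j i))\<^sup>2)"
      using p i by (intro sum.cong refl)
        (auto simp: powr_powr eigvec norm_mult power_mult_distrib powr_numeral)
    also have "\<dots> = (\<Sum>j<n. (cmod (c j i))\<^sup>2)" by (rule parseval[OF rc, symmetric])
    also have "\<dots> = (\<Sum>j<n. (cmod (c i j))\<^sup>2)"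
      using i by (intro sum.cong refl) (simp add: spectral_resolution_hermitian[OF rc i])
    finally have "(T powr (2 / p)) powr (p / 2) \<le> (\<Sum>j<n. (cmod (c i j))\<^sup>2) powr (p / 2)"
      using p by (intro powr_mono2) auto
    also have "\<dots> \<le> (\<Sum>j<n. (cmod (c i j))\<^sup>2 powr (p / 2))"
      using p by (intro powr_sum_le_sum_powr) auto
    also have "\<dots> = (\<Sum>j<n. cmod (c i j) powr p)"
      by (intro sum.cong refl) (simp add: powr_powr flip: powr_numeral)
    finally show ?thesis using p T by (simp add: powr_powr T_def)
  qed
  have "(\<Sum>k<n. \<bar>\<gamma> k\<bar> powr p) = (\<Sum>k<n. (\<Sum>i<n. (cmod (w k i))\<^sup>2) * \<bar>\<gamma> k\<bar> powr p)"
    by (simp add: unit_vec)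
  also have "\<dots> = (\<Sum>i<n. \<Sum>k<n. (cmod (w k i))\<^sup>2 * \<bar>\<gamma> k\<bar> powr p)"
    by (subst sum.swap) (simp add: sum_distrib_right)
  also have "\<dots> \<le> (\<Sum>i<n. \<Sum>j<n. cmod (c i j) powr p)" by (intro sum_mono row) auto
  finally show ?thesis .
qed

section \<open>Wasserstein distance and Stieltjes transform\<close>

text \<open>All empirical measures of \<open>n\<close> eigenvalues are images of one space, the uniform distribution on
  the indices; pairing the two lists index by index then gives a coupling at once.\<close>

lemma spectral_measure_eq_distr:
  fixes l :: "nat \<Rightarrow> real"
  assumes "0 < n" "eigenvalues_mset A = image_mset (\<lambda>i. complex_of_real (l i)) (mset_set {..<n})"
  shows "spectral_measure A = distr (measure_pmf (pmf_of_set {..<n})) borel l"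
proof -
  have "pmf_of_multiset (eigenvalues_mset A) = map_pmf (\<lambda>i. complex_of_real (l i)) (pmf_of_set {..<n})"
    unfolding assms(2) using assms(1) by (intro map_pmf_of_set[symmetric]) auto
  thus ?thesis
    unfolding spectral_measure_def by (simp add: map_pmf_rep_eq distr_distr o_def)
qed

lemma wasserstein_uniform_le:
  fixes l m :: "nat \<Rightarrow> real"
  assumes "0 < n" "0 < p"
  shows "wasserstein p (distr (measure_pmf (pmf_of_set {..<n})) borel l)
      (distr (measure_pmf (pmf_of_set {..<n})) borel m) \<le>
    ennreal (((\<Sum>i<n. \<bar>l i - m i\<bar> powr p) / n) powr (1 / p))"
proof -
  define P where "P = measure_pmf (pmf_of_set {..<n})"
  define \<pi> where "\<pi> = distr P (borel \<Otimes>\<^sub>M borel) (\<lambda>i. (l i, m i))"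
  define C where "C = (\<Sum>i<n. \<bar>l i - m i\<bar> powr p) / n"
  define c where "c = (INF \<pi>\<in>couplings (distr P borel l) (distr P borel m).
    \<integral>\<^sup>+(x, y). ennreal (\<bar>x - y\<bar> powr p) \<partial>\<pi>)"
  have C0: "0 \<le> C" unfolding C_def by (intro divide_nonneg_nonneg sum_nonneg) auto
  have pair [measurable]: "(\<lambda>i. (l i, m i)) \<in> P \<rightarrow>\<^sub>M borel \<Otimes>\<^sub>M borel"
    unfolding P_def by (intro measurable_Pair) simp_all
  have "\<pi> \<in> couplings (distr P borel l) (distr P borel m)"
    unfolding couplings_def \<pi>_def
    by (simp add: distr_distr[OF measurable_fst] distr_distr[OF measurable_snd] o_def)
  hence "c \<le> (\<integral>\<^sup>+(x, y). ennreal (\<bar>x - y\<bar> powr p) \<partial>\<pi>)"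
    unfolding c_def by (rule INF_lower)
  also have "\<dots> = (\<integral>\<^sup>+i. ennreal (\<bar>l i - m i\<bar> powr p) \<partial>P)"
    unfolding \<pi>_def by (subst nn_integral_distr[OF pair]) auto
  also have "\<dots> = (\<Sum>i<n. ennreal (\<bar>l i - m i\<bar> powr p)) / n"
    unfolding P_def using assms(1) by (subst nn_integral_pmf_of_set) (auto simp: ennreal_of_nat_eq_real_of_nat)
  also have "\<dots> = ennreal C"
    unfolding C_def using assms(1)
    by (simp add: divide_ennreal[symmetric] sum_nonneg ennreal_of_nat_eq_real_of_nat)
  finally have c: "c \<le> ennreal C" .
  hence "c \<noteq> \<infinity>" by (metis ennreal_less_top infinity_ennreal_def leD)
  moreover have "enn2real c \<le> C" using enn2real_mono[OF c] C0 by simp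
  hence "enn2real c powr (1 / p) \<le> C powr (1 / p)" using assms(2) by (intro powr_mono2) auto
  ultimately show ?thesis
    unfolding wasserstein_def Let_def P_def[symmetric] C_def[symmetric] c_def[symmetric]
    by (simp add: ennreal_leI)
qed

lemma stieltjes_uniform:
  fixes l :: "nat \<Rightarrow> real"
  assumes "0 < n"
  shows "stieltjes (distr (measure_pmf (pmf_of_set {..<n})) borel l) z =
    (\<Sum>i<n. 1 / (z - complex_of_real (l i))) / of_nat n"
proof -
  have ne: "{..<n} \<noteq> {}" using assms by auto
  have "stieltjes (distr (measure_pmf (pmf_of_set {..<n})) borel l) z =
      (LINT i|measure_pmf (pmf_of_set {..<n}). 1 / (z - complex_of_real (l i)))"
    unfolding stieltjes_def by (subst integral_distr) auto
  also have "\<dots> = (\<Sum>i<n. pmf (pmf_of_set {..<n}) i *\<^sub>R (1 / (z - complex_of_real (l i))))"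
    using assms by (intro integral_measure_pmf) (auto simp: set_pmf_of_set[OF ne])
  also have "\<dots> = (\<Sum>i<n. 1 / (z - complex_of_real (l i)) / of_nat n)"
    using assms by (intro sum.cong refl) (auto simp: scaleR_conv_of_real lessThan_empty_iff)
  finally show ?thesis by (simp add: sum_divide_distrib)
qed

lemma resolvent_lipschitz:
  assumes "2 \<le> Im z"
  shows "cmod (1 / (z - complex_of_real x) - 1 / (z - complex_of_real y)) \<le> \<bar>x - y\<bar>"
proof -
  have ge: "1 \<le> cmod (z - complex_of_real t)" for t
    using abs_Im_le_cmod[of "z - complex_of_real t"] assms by simp
  hence nz: "z - complex_of_real t \<noteq> 0" for t by (metis norm_zero not_one_le_zero)
  have "1 / (z - complex_of_real x) - 1 / (z - complex_of_real y) =
      complex_of_real (x - y) / ((z - complex_of_real x) * (z - complex_of_real y))"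
    using nz[of x] nz[of y] by (simp add: field_simps)
  hence "cmod (1 / (z - complex_of_real x) - 1 / (z - complex_of_real y)) =
      \<bar>x - y\<bar> / (cmod (z - complex_of_real x) * cmod (z - complex_of_real y))"
    by (simp only: norm_divide norm_mult norm_of_real)
  also have "\<dots> \<le> \<bar>x - y\<bar> / 1"
    using mult_mono[OF ge[of x] ge[of y]] by (intro divide_left_mono) auto
  finally show ?thesis by simp
qed

text \<open>The difference of the transforms is at most the mean of \<open>|l i - m i|\<close>, as the resolvent is
  1-Lipschitz on the real line when the imaginary part is at least \<open>2\<close>; the mean is at most the
  \<open>p\<close>-th power mean.\<close>

lemma stieltjes_uniform_diff_le:
  fixes l m :: "nat \<Rightarrow> real"
  assumes n: "0 < n" and p: "1 \<le> p" and z: "2 \<le> Im z"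
  shows "cmod (stieltjes (distr (measure_pmf (pmf_of_set {..<n})) borel l) z -
      stieltjes (distr (measure_pmf (pmf_of_set {..<n})) borel m) z) \<le>
    ((\<Sum>i<n. \<bar>l i - m i\<bar> powr p) / n) powr (1 / p)"
proof -
  define M where "M = (\<Sum>i<n. \<bar>l i - m i\<bar>) / n"
  have M: "0 \<le> M" unfolding M_def by (intro divide_nonneg_nonneg sum_nonneg) auto
  have "cmod (stieltjes (distr (measure_pmf (pmf_of_set {..<n})) borel l) z -
      stieltjes (distr (measure_pmf (pmf_of_set {..<n})) borel m) z) =
    cmod (\<Sum>i<n. 1 / (z - complex_of_real (l i)) - 1 / (z - complex_of_real (m i))) / n"
    unfolding stieltjes_uniform[OF n] diff_divide_distrib[symmetric] sum_subtractf
    by (simp add: norm_divide)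
  also have "\<dots> \<le> M"
    unfolding M_def by (intro divide_right_mono sum_norm_le resolvent_lipschitz z) auto
  also have "M = (M powr p) powr (1 / p)" using M p by (simp add: powr_powr)
  also have "M powr p \<le> (\<Sum>i<n. \<bar>l i - m i\<bar> powr p) / n"
    using powr_jensen[OF p, of n "\<lambda>_. 1 / n" "\<lambda>i. \<bar>l i - m i\<bar>"] n
    by (simp add: M_def sum_divide_distrib)
  hence "(M powr p) powr (1 / p) \<le> ((\<Sum>i<n. \<bar>l i - m i\<bar> powr p) / n) powr (1 / p)"
    using p by (intro powr_mono2) auto
  finally show ?thesis .
qed

lemma herm_mats_self_adjoint:
  assumes "b \<in> {1, 2}" "A \<in> herm_mats b n"
  shows "A \<in> carrier_mat n n" "mat_adjoint A = A"
proof -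
  show A: "A \<in> carrier_mat n n" using assms by (auto simp: herm_mats_def split: if_splits)
  show "mat_adjoint A = A"
  proof (cases "b = 1")
    case True
    hence sym: "transpose_mat A = A" and real: "elements_mat A \<subseteq> \<real>"
      using assms by (auto simp: herm_mats_def)
    show ?thesis
    proof (rule eq_matI)
      fix i j assume ij: "i < dim_row A" "j < dim_col A"
      hence "A $$ (j, i) = A $$ (i, j)" using A by (subst sym[symmetric]) auto
      moreover have "A $$ (j, i) \<in> \<real>" using real ij A by (force simp: elements_mat_def)
      ultimately show "mat_adjoint A $$ (i, j) = A $$ (i, j)"
        using ij A by (auto simp: Reals_cnj_iff)
    qed (use A in auto)
  qed (use assms in \<open>auto simp: herm_mats_def\<close>)
qed

theorem lemma2p20:
  fixes b n :: nat and p :: real and A B :: "complex mat" and K :: "complex set"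
  assumes "n \<ge> 1" and "b \<in> {1, 2}" and "p \<in> {1..2}"
    and "A \<in> herm_mats b n" and "B \<in> herm_mats b n"
    and "compact K" and "K \<subseteq> {z. Im z \<ge> 2}" and "\<exists>z. z islimpt K" and "diameter K \<le> 1"
  shows "wasserstein p (spectral_measure A) (spectral_measure B)
           \<le> ennreal (1 / real n powr (1 / p) * lp_norm_mat p (A - B)) \<and>
         stieltjes_dist K (spectral_measure A) (spectral_measure B)
           \<le> 1 / real n powr (1 / p) * lp_norm_mat p (A - B)"
proof -
  have n: "0 < n" and p: "1 \<le> p" "p \<le> 2" using assms(1,3) by auto
  note A = herm_mats_self_adjoint[OF assms(2,4)] and B = herm_mats_self_adjoint[OF assms(2,5)]
  obtain u \<alpha> where \<alpha>: "spectral_resolution n (\<lambda>i j. A $$ (i, j)) u \<alpha>" "nonincreasing n \<alpha>"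
    "eigenvalues_mset A = image_mset (\<lambda>i. complex_of_real (\<alpha> i)) (mset_set {..<n})"
    by (rule hermitian_spectral_resolution[OF A])
  obtain v \<beta> where \<beta>: "spectral_resolution n (\<lambda>i j. B $$ (i, j)) v \<beta>" "nonincreasing n \<beta>"
    "eigenvalues_mset B = image_mset (\<lambda>i. complex_of_real (\<beta> i)) (mset_set {..<n})"
    by (rule hermitian_spectral_resolution[OF B])
  have "A $$ (j, i) - B $$ (j, i) = cnj (A $$ (i, j) - B $$ (i, j))" if "i < n" "j < n" for i j
    using spectral_resolution_hermitian[OF \<alpha>(1) that] spectral_resolution_hermitian[OF \<beta>(1) that]
    by simp
  then obtain w \<gamma> where \<gamma>: "spectral_resolution n (\<lambda>i j. A $$ (i, j) - B $$ (i, j)) w \<gamma>"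
    by (rule spectral_resolution_exists)
  define S where "S = (\<Sum>i<n. \<Sum>j<n. cmod (A $$ (i, j) - B $$ (i, j)) powr p)"
  define L where "L = (\<Sum>i<n. \<bar>\<alpha> i - \<beta> i\<bar> powr p)"
  have "L \<le> (\<Sum>k<n. \<bar>\<gamma> k\<bar> powr p)"
    unfolding L_def by (rule sum_powr_eigenvalue_differences_le[OF \<alpha>(1) \<beta>(1) \<alpha>(2) \<beta>(2) \<gamma> p(1)])
  also have "\<dots> \<le> S"
    unfolding S_def by (rule sum_powr_eigenvalues_le_entries[OF \<gamma> p])
  finally have LS: "L \<le> S" .
  have L0: "0 \<le> L" unfolding L_def by (intro sum_nonneg) auto
  have "lp_norm_mat p (A - B) = S powr (1 / p)"
    unfolding lp_norm_mat_def S_def using A(1) B(1) by auto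
  hence rhs: "1 / real n powr (1 / p) * lp_norm_mat p (A - B) = (S / n) powr (1 / p)"
    using LS L0 by (simp add: powr_divide)
  have bound: "(L / n) powr (1 / p) \<le> 1 / real n powr (1 / p) * lp_norm_mat p (A - B)"
    unfolding rhs using LS L0 p by (intro powr_mono2 divide_right_mono) auto
  note \<mu>A = spectral_measure_eq_distr[OF n \<alpha>(3)] and \<mu>B = spectral_measure_eq_distr[OF n \<beta>(3)]
  have "wasserstein p (spectral_measure A) (spectral_measure B) \<le> ennreal ((L / n) powr (1 / p))"
    unfolding \<mu>A \<mu>B L_def using n p by (intro wasserstein_uniform_le) auto
  also have "\<dots> \<le> ennreal (1 / real n powr (1 / p) * lp_norm_mat p (A - B))"
    by (rule ennreal_leI[OF bound])
  finally have W: "wasserstein p (spectral_measure A) (spectral_measure B)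
    \<le> ennreal (1 / real n powr (1 / p) * lp_norm_mat p (A - B))" .
  have "K \<noteq> {}" using assms(8) by auto
  hence "stieltjes_dist K (spectral_measure A) (spectral_measure B) \<le> (L / n) powr (1 / p)"
    unfolding stieltjes_dist_def \<mu>A \<mu>B L_def using assms(7) n p
    by (intro cSUP_least stieltjes_uniform_diff_le) auto
  with W bound show ?thesis by linarith
qed

end
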